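(* Let $v_1,\ldots,v_p\in\mathbb{C}^n$ and $V=\operatorname{span}_{\mathbb{R}}\{v_1,\ldots,v_p\}\subset(\mathbb{C}^n)_{\mathbb{R}}$. Then: (i) $\rho_V^2=\sin\Upsilon_{V,\mathrm{i}V}$. (ii) $\|v_1\wedge\cdots\wedge v_p\|=\rho_V\cdot\|v_1\vartriangle\cdots\vartriangle v_p\|$.
   Context: $(\mathbb{C}^n)_{\mathbb{R}}=\mathbb{R}^{2n}$ is the underlying real space of $\mathbb{C}^n$, with inner product $\langle\cdot,\cdot\rangle_{\mathbb{R}}=\operatorname{Re}\langle\cdot,\cdot\rangle$, where $\langle\cdot,\cdot\rangle$ is the canonical Hermitian product of $\mathbb{C}^n$. $\wedge$ is the $\mathbb{C}$-bilinear exterior product of $\bigwedge\mathbb{C}^n$ and $\vartriangle$ is the $\mathbb{R}$-bilinear exterior product of $\bigwedge(\mathbb{C}^n)_{\mathbb{R}}$. Norms are those of the induced Hermitian/inner products, so that $\|v_1\wedge\cdots\wedge v_k\|=\sqrt{\det(\langle v_i,v_j\rangle)}$ and $\|v_1\vartriangle\cdots\vartriangle v_k\|=\sqrt{\det(\langle v_i,v_j\rangle_{\mathbb{R}})}$. Principal angles: for real subspaces $V,W\subset(\mathbb{C}^n)_{\mathbb{R}}$ with $m=\min\{\dim V,\dim W\}$, the principal angles $0\le\theta_1\le\cdots\le\theta_m\le\frac\pi2$ are those for which there are orthonormal bases $(a_1,a_2,\ldots)$ of $V$ and $(b_1,b_2,\ldots)$ of $W$ (principal bases) with $\langle a_j,b_k\rangle_{\mathbb{R}}=0$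 for $j\ne k$ and $\langle a_j,b_j\rangle_{\mathbb{R}}=\cos\theta_j$ for $1\le j\le m$. Holomorphy index: for a real subspace $V\subset(\mathbb{C}^n)_{\mathbb{R}}$ of real dimension $d$, let $\mathrm{i}V=\{\mathrm{i}v:v\in V\}$ and let $\theta_1\le\cdots\le\theta_d$ be the principal angles of $V$ and $\mathrm{i}V$ in $(\mathbb{C}^n)_{\mathbb{R}}$. (It is known that $\theta_{2j-1}=\theta_{2j}$ for $1\le j\le\lfloor d/2\rfloor$, and $\theta_d=\frac\pi2$ if $d$ is odd.) The Kähler angles of $V$ are $\mu_j=\theta_{2j-1}$ for $1\le j\le h=\lceil d/2\rceil$, and the holomorphy index of $V$ is $\rho_V=\prod_{j=1}^h\sin\mu_j$. Disjointness angle: for real subspaces $V,W\subset(\mathbb{C}^n)_{\mathbb{R}}$, $\Upsilon_{V,W}=\sin^{-1}\frac{\|P_{W^\perp}B\|}{\|B\|}\in[0,\frac\pi2]$, where $B=b_1\vartriangle\cdots\vartriangle b_d\in\bigwedge^d(\mathbb{C}^n)_{\mathbb{R}}$ for any basis $(b_1,\ldots,b_d)$ of $V$, $P_{W^\perp}$ is the orthogonal projection on the orthogonal complement of $W$ in $(\mathbb{C}^n)_{\mathbb{R}}$, and $P_{W^\perp}B=(P_{W^\perp}b_1)\vartriangle\cdots\vartriangle(P_{W^\perp}b_d)$. In the degenerate case $V=\{0\}$, the empty product is $1$ and $B$ is a nonzero scalar with $P_{W^\perp}B=B$. *)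

theory Defs
  imports "HOL-Analysis.Analysis"
begin

text \<open>
  Throughout, the real space underlying complex n-space is the type \<open>complex^'n\<close> with the
  library's real structure: \<open>span\<close>, \<open>dim\<close> and \<open>independent\<close> are taken over the reals, and
  \<open>\<bullet>\<close> is the real part of the canonical Hermitian product (lemma \<open>inner_eq_Re_herm\<close>).
\<close>

definition herm :: "complex^'n \<Rightarrow> complex^'n \<Rightarrow> complex" where
  "herm x y = (\<Sum>i\<in>UNIV. x $ i * cnj (y $ i))"

lemma inner_eq_Re_herm: "x \<bullet> y = Re (herm x y)"
  by (simp add: herm_def inner_vec_def inner_complex_def)


section \<open>Exterior powers\<close>

text \<open>
  A \<open>k\<close>-vector is represented by the alternating tensor of its coordinates, a function of
  multi-indices \<open>t : {1..k} \<rightarrow> I\<close>, where \<open>I\<close> indexes an orthonormal basis of the space. In this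
  model the product \<open>v 1 \<and> \<dots> \<and> v k\<close> is
  the sum over all permutations \<open>\<sigma>\<close> of \<open>{1..k}\<close> of the tensors
  \<open>sign \<sigma> v (\<sigma> 1) \<otimes> \<dots> \<otimes> v (\<sigma> k)\<close>,
  and the induced inner product is the one of the tensor power divided by \<open>k!\<close>, which makes the
  \<open>k\<close>-fold products of distinct basis vectors orthonormal up to sign.
  For \<open>k = 0\<close> one gets the scalars, and the empty product is the scalar 1.
\<close>

definition ext_prod ::
    "('a \<Rightarrow> 'i \<Rightarrow> 'k::comm_ring_1) \<Rightarrow> nat \<Rightarrow> (nat \<Rightarrow> 'a) \<Rightarrow> (nat \<Rightarrow> 'i) \<Rightarrow> 'k" where
  "ext_prod coord k v = (\<lambda>t. \<Sum>\<sigma> | \<sigma> permutes {1..k}.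
     of_int (sign \<sigma>) * (\<Prod>a=1..k. coord (v (\<sigma> a)) (t a)))"

definition ext_norm :: "'i set \<Rightarrow> nat \<Rightarrow> ((nat \<Rightarrow> 'i) \<Rightarrow> 'k::real_normed_field) \<Rightarrow> real" where
  "ext_norm I k T = sqrt ((\<Sum>t \<in> {1..k} \<rightarrow>\<^sub>E I. (norm (T t))\<^sup>2) / fact k)"

text \<open>The complex exterior product \<open>v 1 \<and> \<dots> \<and> v k\<close>, in coordinates of the canonical basis.\<close>

definition cwedge :: "nat \<Rightarrow> (nat \<Rightarrow> complex^'n) \<Rightarrow> (nat \<Rightarrow> 'n) \<Rightarrow> complex" where
  "cwedge = ext_prod (\<lambda>v i. v $ i)"

definition cwedge_norm :: "nat \<Rightarrow> ((nat \<Rightarrow> 'n::finite) \<Rightarrow> complex) \<Rightarrow> real" where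
  "cwedge_norm = ext_norm UNIV"

text \<open>The real exterior product, in coordinates of the orthonormal basis \<open>Basis\<close>.\<close>

definition rwedge :: "nat \<Rightarrow> (nat \<Rightarrow> 'a::euclidean_space) \<Rightarrow> (nat \<Rightarrow> 'a) \<Rightarrow> real" where
  "rwedge = ext_prod (\<bullet>)"

definition rwedge_norm :: "nat \<Rightarrow> ((nat \<Rightarrow> 'a::euclidean_space) \<Rightarrow> real) \<Rightarrow> real" where
  "rwedge_norm = ext_norm Basis"

text \<open>The norms of products of vectors are given by Gram determinants.\<close>

definition gram_det :: "('a \<Rightarrow> 'a \<Rightarrow> 'k::comm_ring_1) \<Rightarrow> nat \<Rightarrow> (nat \<Rightarrow> 'a) \<Rightarrow> 'k" where
  "gram_det ip k v = (\<Sum>\<sigma> | \<sigma> permutes {1..k}.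
     of_int (sign \<sigma>) * (\<Prod>a=1..k. ip (v a) (v (\<sigma> a))))"

lemma sum_ext_prod_mult:
  fixes c d :: "'a \<Rightarrow> 'i \<Rightarrow> 'k::{comm_ring_1,semiring_char_0}"
  assumes I: "finite I"
  shows "(\<Sum>t \<in> {1..k} \<rightarrow>\<^sub>E I. ext_prod c k v t * ext_prod d k v t)
       = fact k * gram_det (\<lambda>x y. \<Sum>i\<in>I. c x i * d y i) k v"
proof -
  let ?P = "{\<sigma>. \<sigma> permutes {1..k}}"
  let ?G = "\<lambda>x y. \<Sum>i\<in>I. c x i * d y i"
  let ?s = "\<lambda>\<sigma>. of_int (sign \<sigma>) :: 'k"
  have "(\<Sum>t \<in> {1..k} \<rightarrow>\<^sub>E I. ext_prod c k v t * ext_prod d k v t)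
      = (\<Sum>t \<in> {1..k} \<rightarrow>\<^sub>E I. \<Sum>\<sigma>\<in>?P. \<Sum>\<tau>\<in>?P. ?s \<sigma> * ?s \<tau> *
          (\<Prod>a=1..k. c (v (\<sigma> a)) (t a) * d (v (\<tau> a)) (t a)))"
    by (simp add: ext_prod_def sum_product prod.distrib mult_ac)
  also have "\<dots> = (\<Sum>\<sigma>\<in>?P. \<Sum>\<tau>\<in>?P. \<Sum>t \<in> {1..k} \<rightarrow>\<^sub>E I. ?s \<sigma> * ?s \<tau> *
          (\<Prod>a=1..k. c (v (\<sigma> a)) (t a) * d (v (\<tau> a)) (t a)))"
    by (subst sum.swap, rule sum.cong[OF refl], subst sum.swap, rule refl)
  also have "\<dots> = (\<Sum>\<sigma>\<in>?P. \<Sum>\<tau>\<in>?P. ?s \<sigma> * ?s \<tau> * (\<Prod>a=1..k. ?G (v (\<sigma> a)) (v (\<tau> a))))"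
    by (subst prod_sum_PiE) (simp_all add: I sum_distrib_left)
  also have "\<dots> = (\<Sum>\<sigma>\<in>?P. gram_det ?G k v)"
  proof (rule sum.cong[OF refl])
    fix \<sigma> assume "\<sigma> \<in> ?P"
    then have \<sigma>: "\<sigma> permutes {1..k}" by simp
    have "(\<Sum>\<tau>\<in>?P. ?s \<sigma> * ?s \<tau> * (\<Prod>a=1..k. ?G (v (\<sigma> a)) (v (\<tau> a))))
        = (\<Sum>\<pi>\<in>?P. ?s \<sigma> * ?s (\<pi> \<circ> \<sigma>) * (\<Prod>a=1..k. ?G (v (\<sigma> a)) (v ((\<pi> \<circ> \<sigma>) a))))"
      by (rule sum_permutations_compose_right[OF \<sigma>])
    also have "\<dots> = gram_det ?G k v"
      unfolding gram_det_def
    proof (rule sum.cong[OF refl])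
      fix \<pi> assume "\<pi> \<in> ?P"
      then have \<pi>: "\<pi> permutes {1..k}" by simp
      have "sign (\<pi> \<circ> \<sigma>) = sign \<pi> * sign \<sigma>"
        using \<pi> \<sigma> by (intro sign_compose) (auto intro: permutation_permutes[THEN iffD2])
      then have "?s \<sigma> * ?s (\<pi> \<circ> \<sigma>) = of_int (sign \<sigma> * sign \<sigma>) * ?s \<pi>"
        by (simp add: mult_ac del: sign_idempotent)
      then have s: "?s \<sigma> * ?s (\<pi> \<circ> \<sigma>) = ?s \<pi>" by simp
      have "(\<Prod>a=1..k. ?G (v (\<sigma> a)) (v ((\<pi> \<circ> \<sigma>) a))) = (\<Prod>a=1..k. ?G (v a) (v (\<pi> a)))"
        using prod.permute[OF \<sigma>, of "\<lambda>a. ?G (v a) (v (\<pi> a))"] by (simp add: o_def)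
      then show "?s \<sigma> * ?s (\<pi> \<circ> \<sigma>) * (\<Prod>a=1..k. ?G (v (\<sigma> a)) (v ((\<pi> \<circ> \<sigma>) a)))
          = ?s \<pi> * (\<Prod>a=1..k. ?G (v a) (v (\<pi> a)))"
        using s by simp
    qed
    finally show "(\<Sum>\<tau>\<in>?P. ?s \<sigma> * ?s \<tau> * (\<Prod>a=1..k. ?G (v (\<sigma> a)) (v (\<tau> a)))) = gram_det ?G k v" .
  qed
  also have "\<dots> = fact k * gram_det ?G k v"
    using card_permutations[of "{1..k}" k] by simp
  finally show ?thesis .
qed

lemma rwedge_norm_gram: "rwedge_norm k (rwedge k v) = sqrt (gram_det (\<bullet>) k v)"
proof -
  have ip: "(\<lambda>x y. \<Sum>i\<in>Basis. (x \<bullet> i) * (y \<bullet> i)) = ((\<bullet>) :: 'a \<Rightarrow> 'a \<Rightarrow> real)"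
    by (intro ext) (simp add: euclidean_inner[symmetric])
  show ?thesis
    using sum_ext_prod_mult[OF finite_Basis, of "(\<bullet>)" k v "(\<bullet>)"]
    by (simp add: rwedge_norm_def rwedge_def ext_norm_def power2_eq_square ip)
qed

lemma cwedge_norm_gram:
  "complex_of_real ((cwedge_norm k (cwedge k v))\<^sup>2) = gram_det herm k v"
proof -
  have cnj: "cnj (ext_prod (\<lambda>v i. v $ i) k v t) = ext_prod (\<lambda>v i. cnj (v $ i)) k v t" for t
    by (simp add: ext_prod_def)
  have ip: "herm = (\<lambda>x y. \<Sum>i\<in>UNIV. x $ i * cnj (y $ i))"
    by (intro ext) (simp add: herm_def)
  have nn: "0 \<le> (\<Sum>t \<in> {1..k} \<rightarrow>\<^sub>E UNIV. (norm (ext_prod (\<lambda>v i. v $ i) k v t))\<^sup>2)"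
    by (intro sum_nonneg) simp
  have "complex_of_real (\<Sum>t \<in> {1..k} \<rightarrow>\<^sub>E UNIV. (norm (ext_prod (\<lambda>v i. v $ i) k v t))\<^sup>2)
      = fact k * gram_det herm k v"
    unfolding of_real_sum complex_norm_square cnj ip
    by (rule sum_ext_prod_mult) simp
  then show ?thesis
    using nn by (simp add: cwedge_norm_def cwedge_def ext_norm_def)
qed


section \<open>Principal angles and holomorphy index\<close>

definition orthonormal_basis :: "'a::euclidean_space set \<Rightarrow> (nat \<Rightarrow> 'a) \<Rightarrow> bool" where
  "orthonormal_basis V a \<longleftrightarrow>
     (\<forall>j\<in>{1..dim V}. \<forall>k\<in>{1..dim V}. a j \<bullet> a k = (if j = k then 1 else 0)) \<and>
     span (a ` {1..dim V}) = V"

text \<open>Only the values \<open>\<theta> j\<close> with \<open>1 \<le> j \<le> min (dim V) (dim W)\<close> are meaningful.\<close>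

definition are_principal_angles ::
    "'a::euclidean_space set \<Rightarrow> 'a set \<Rightarrow> (nat \<Rightarrow> real) \<Rightarrow> bool" where
  "are_principal_angles V W \<theta> \<longleftrightarrow>
     (let m = min (dim V) (dim W) in
       (\<forall>j\<in>{1..m}. 0 \<le> \<theta> j \<and> \<theta> j \<le> pi / 2) \<and>
       (\<forall>j\<in>{1..m}. \<forall>k\<in>{1..m}. j \<le> k \<longrightarrow> \<theta> j \<le> \<theta> k) \<and>
       (\<exists>a b. orthonormal_basis V a \<and> orthonormal_basis W b \<and>
          (\<forall>j\<in>{1..dim V}. \<forall>k\<in>{1..dim W}. j \<noteq> k \<longrightarrow> a j \<bullet> b k = 0) \<and>
          (\<forall>j\<in>{1..m}. a j \<bullet> b j = cos (\<theta> j))))"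

text \<open>
  For subspaces, principal angles exist and their meaningful values are unique, being the
  arccosines of the singular values of the orthogonal projection from \<open>V\<close> to \<open>W\<close>.
\<close>

definition principal_angle :: "'a::euclidean_space set \<Rightarrow> 'a set \<Rightarrow> nat \<Rightarrow> real" where
  "principal_angle V W = (SOME \<theta>. are_principal_angles V W \<theta>)"

definition imult :: "(complex^'n) set \<Rightarrow> (complex^'n) set" where
  "imult V = (\<lambda>v. \<i> *s v) ` V"

definition kaehler_angle :: "(complex^'n) set \<Rightarrow> nat \<Rightarrow> real" where
  "kaehler_angle V j = principal_angle V (imult V) (2 * j - 1)"

definition holomorphy_index :: "(complex^'n) set \<Rightarrow> real" where
  "holomorphy_index V = (\<Prod>j = 1..nat \<lceil>real (dim V) / 2\<rceil>. sin (kaehler_angle V j))"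


section \<open>Disjointness angle\<close>

definition orth_proj :: "'a::euclidean_space set \<Rightarrow> 'a \<Rightarrow> 'a" where
  "orth_proj S x = (THE y. y \<in> S \<and> x - y \<in> S\<^sup>\<bottom>)"

definition is_basis :: "'a::euclidean_space set \<Rightarrow> (nat \<Rightarrow> 'a) \<Rightarrow> bool" where
  "is_basis V b \<longleftrightarrow>
     inj_on b {1..dim V} \<and> independent (b ` {1..dim V}) \<and> span (b ` {1..dim V}) = V"

text \<open>
  The choice of the basis is immaterial: a change of basis multiplies both \<open>k\<close>-vectors below by
  the same nonzero determinant.
\<close>

definition disjointness_angle :: "'a::euclidean_space set \<Rightarrow> 'a set \<Rightarrow> real" where
  "disjointness_angle V W =
     (let d = dim V; b = (SOME b. is_basis V b) in
       arcsin (rwedge_norm d (rwedge d (\<lambda>j. orth_proj (W\<^sup>\<bottom>) (b j)))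
               / rwedge_norm d (rwedge d b)))"

end

theory Submission
  imports Defs "Jordan_Normal_Form.Determinant"
begin

text \<open>
  Let \<open>d = dim V\<close> and let \<open>a\<close>, \<open>b\<close> be principal bases of \<open>V\<close> and \<open>\<i>V\<close>, so that
  \<open>\<langle>a j, b k\<rangle>\<close> is zero for \<open>j \<noteq> k\<close> and \<open>s j = cos \<theta>\<^sub>j\<close> for \<open>j = k\<close>. Both claims
  are computations of a determinant that equals \<open>(1 - (s 1)\<^sup>2) \<cdots> (1 - (s d)\<^sup>2)\<close>.

  The principal angles come in pairs, with a right angle left over if \<open>d\<close> is odd
  (\<open>cosines_paired\<close>): the matrix between the bases \<open>a\<close> and \<open>- \<i> b\<close> of \<open>V\<close> is orthogonal,
  and skewness of multiplication by \<open>\<i>\<close> makes it skew-symmetric on each block of indices with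
  the same positive cosine; a skew-symmetric matrix of odd size is singular, so these blocks have
  even size. Hence \<open>\<rho>\<^sup>2\<close> is the product of the sines of all \<open>d\<close> principal angles
  (\<open>holomorphy_index_squared\<close>).

  For the first claim, the projection to the orthogonal complement of \<open>\<i>V\<close> takes the basis
  \<open>a\<close> to orthogonal vectors of norms \<open>sin \<theta>\<^sub>j\<close>, and the ratio in the definition of the
  disjointness angle can be computed in any basis (\<open>sin_disjointness_angle\<close>).

  For the second claim, a real change of basis multiplies the real and the complex Gram
  determinant by the same factor, the square of the determinant of the coefficient matrix
  (\<open>gram_det_generators\<close>), so the generators may be replaced by \<open>a\<close>. The complex Gram matrix
  of \<open>a\<close> is \<open>H = 1 + \<i> S\<close> with \<open>S\<close> real and skew-symmetric, and its determinant is real and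
  nonnegative. The matrix \<open>H H\<^sup>T = 1 - S S\<^sup>T\<close> is the real Gram matrix of the projections of
  \<open>a\<close> to the orthogonal complement of \<open>\<i>V\<close>. So \<open>(det H)\<^sup>2\<close> is the product of the squared
  sines (\<open>gram_det_herm_squared\<close>), which is \<open>\<rho>\<^sup>4\<close>, and \<open>det H = \<rho>\<^sup>2\<close>.
\<close>

(* Inner products, vector components and orthogonality are those of Euclidean space; the symbols
   of the same name for matrices are set aside. *)
hide_const (open) Matrix.orthogonal
hide_fact (open) Matrix.orthogonal_def Matrix.vec_eq_iff
no_notation Matrix.vec_index (infixl "$" 100)
no_notation Matrix.scalar_prod (infix "\<bullet>" 70)


section \<open>Determinants indexed from one\<close>

text \<open>
  The Gram determinant of the index sequence itself is the Leibniz determinant of the matrix with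
  rows and columns indexed by \<open>{1..k}\<close>. Matrices are kept as functions of two indices, so that
  a determinant can be compared with a Gram determinant over any ring.
\<close>
abbreviation ldet :: "nat \<Rightarrow> (nat \<Rightarrow> nat \<Rightarrow> 'k::comm_ring_1) \<Rightarrow> 'k" where
  "ldet k A \<equiv> gram_det A k (\<lambda>i. i)"

lemma gram_det_eq_ldet: "gram_det ip k v = ldet k (\<lambda>i j. ip (v i) (v j))"
  by (simp add: gram_det_def)

lemma ldet_cong:
  assumes "\<And>i j. i \<in> {1..k} \<Longrightarrow> j \<in> {1..k} \<Longrightarrow> A i j = B i j"
  shows "ldet k A = ldet k B"
  unfolding gram_det_def
  by (intro sum.cong refl arg_cong2[where f = "(*)"] prod.cong)
     (metis assms mem_Collect_eq permutes_in_image)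

text \<open>
  The transfer to the library's determinants of matrices indexed by \<open>{0..<k}\<close>, which supplies
  multiplicativity and invariance under transposition.
\<close>
lemma gram_det_eq_det:
  "gram_det ip k v = det (mat k k (\<lambda>(i, j). ip (v (Suc i)) (v (Suc j))))"
proof -
  \<comment> \<open>permutations of the two index sets correspond by conjugation with the shift by one\<close>
  have bij: "bij_betw Suc {0..<k} {1..k}"
    by (simp add: bij_betw_def atLeastLessThanSuc_atLeastAtMost)
  let ?m = "map_permutation {0..<k} Suc"
  let ?m' = "map_permutation {1..k} (inv_into {0..<k} Suc)"
  have "gram_det ip k v = (\<Sum>\<sigma> | \<sigma> permutes {0..<k}.
     of_int (sign \<sigma>) * (\<Prod>i=0..<k. ip (v (Suc i)) (v (Suc (\<sigma> i)))))"
    unfolding gram_det_def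
  proof (rule sum.reindex_bij_witness[of _ ?m ?m'], goal_cases)
    case (1 \<sigma>)
    then show ?case
      using map_permutation_compose_inv[OF bij_betw_inv_into[OF bij], of \<sigma> Suc]
      by (auto simp: bij_betw_inv_into_right[OF bij])
  next
    case (2 \<sigma>)
    then show ?case
      using map_permutation_permutes[OF bij_betw_inv_into[OF bij]] by auto
  next
    case (3 \<sigma>)
    then show ?case
      using map_permutation_compose_inv[OF bij, of \<sigma>] 
      by (auto simp: bij_betw_inv_into_left[OF bij])
  next
    case (4 \<sigma>)
    then show ?case
      using map_permutation_permutes[OF bij] by auto
  next
    case (5 \<sigma>)
    then have \<sigma>: "\<sigma> permutes {1..k}" by simp
    let ?i = "inv_into {0..<k} Suc"
    have inj: "inj_on ?i {1..k}"
      using bij_betw_inv_into[OF bij] by (auto simp: bij_betw_def)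
    have s: "sign (?m' \<sigma>) = sign \<sigma>"
      by (rule sign_map_permutation[OF inj \<sigma>]) simp
    have "?m' \<sigma> i = ?i (\<sigma> (Suc i))" if "i < k" for i
      using map_permutation_apply[OF inj, of "Suc i" \<sigma>] that bij_betw_inv_into_left[OF bij, of i]
      by simp
    then have "Suc (?m' \<sigma> i) = \<sigma> (Suc i)" if "i < k" for i
      using that permutes_in_image[OF \<sigma>, of "Suc i"]
      by (simp add: bij_betw_inv_into_right[OF bij])
    then have "(\<Prod>i=0..<k. ip (v (Suc i)) (v (Suc (?m' \<sigma> i)))) = (\<Prod>a=1..k. ip (v a) (v (\<sigma> a)))"
      by (simp add: prod.atLeast1_atMost_eq atLeast0LessThan)
    then show ?case unfolding s by simp
  qed
  also have "\<dots> = det (mat k k (\<lambda>(i, j). ip (v (Suc i)) (v (Suc j))))"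
    by (auto simp: det_def'[of _ k] permutes_in_image sign_def intro!: sum.cong prod.cong)
  finally show ?thesis .
qed

lemma ldet_mult: "ldet k (\<lambda>i j. \<Sum>l=1..k. A i l * B l j) = ldet k A * ldet k B"
proof -
  let ?A = "mat k k (\<lambda>(i, j). A (Suc i) (Suc j))" and ?B = "mat k k (\<lambda>(i, j). B (Suc i) (Suc j))"
  have "mat k k (\<lambda>(i, j). \<Sum>l=1..k. A (Suc i) l * B l (Suc j)) = ?A * ?B"
    by (intro eq_matI) (auto simp: scalar_prod_def sum.atLeast1_atMost_eq atLeast0LessThan)
  then show ?thesis
    by (simp add: gram_det_eq_det det_mult[of _ k])
qed

lemma ldet_transpose: "ldet k (\<lambda>i j. A j i) = ldet k A"
proof -
  have "mat k k (\<lambda>(i, j). A (Suc j) (Suc i)) = transpose_mat (mat k k (\<lambda>(i, j). A (Suc i) (Suc j)))"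
    by (intro eq_matI) auto
  then show ?thesis
    by (simp add: gram_det_eq_det det_transpose[of _ k])
qed

lemma ldet_diag: "ldet k (\<lambda>i j. if i = j then f i else 0) = (\<Prod>i=1..k. f i)"
proof -
  have "ldet k (\<lambda>i j. if i = j then f i else 0) =
      prod_list (diag_mat (mat k k (\<lambda>(i, j). if i = j then f (Suc i) else 0)))"
    by (simp add: gram_det_eq_det) (rule det_upper_triangular[of _ k], auto)
  also have "\<dots> = (\<Prod>i=1..k. f i)"
    by (simp add: prod_list_diag_prod prod.atLeast1_atMost_eq atLeast0LessThan)
  finally show ?thesis .
qed

lemma ldet_uminus: "ldet k (\<lambda>i j. - A i j) = (-1) ^ k * ldet k A"
  by (simp add: gram_det_def prod_uminus sum_distrib_left mult_ac)

lemma ldet_zero_column: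
  assumes l: "l \<in> {1..k}" and 0: "\<And>i. i \<in> {1..k} \<Longrightarrow> A i l = 0"
  shows "ldet k A = 0"
  unfolding gram_det_def
proof (intro sum.neutral ballI)
  fix \<sigma> assume "\<sigma> \<in> {\<sigma>. \<sigma> permutes {1..k}}"
  then have \<sigma>: "\<sigma> permutes {1..k}" by simp
  then obtain i where "i \<in> {1..k}" "\<sigma> i = l"
    using l by (metis permutes_image imageE)
  then have "(\<Prod>a=1..k. A a (\<sigma> a)) = 0"
    using 0 by (intro prod_zero bexI[of _ i]) auto
  then show "of_int (sign \<sigma>) * (\<Prod>a=1..k. A a (\<sigma> a)) = 0" by simp
qed

lemma ldet_of_real: "ldet k (\<lambda>i j. of_real (A i j)) = of_real (ldet k A)"
  by (simp add: gram_det_def)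

text \<open>
  If \<open>x = C a\<close>, then the Gram matrices satisfy \<open>G x = C G a C\<^sup>T\<close>, so that the
  determinant of \<open>C\<close> appears twice.
\<close>
lemma gram_det_change_of_basis:
  assumes ip: "\<And>i j. i \<in> {1..k} \<Longrightarrow> j \<in> {1..k} \<Longrightarrow>
      ip (x i) (x j) = (\<Sum>l=1..k. C i l * (\<Sum>m=1..k. ip (a l) (a m) * C j m))"
  shows "gram_det ip k x = (ldet k C)\<^sup>2 * gram_det ip k a"
proof -
  have "gram_det ip k x = ldet k (\<lambda>i j. \<Sum>l=1..k. C i l * (\<Sum>m=1..k. ip (a l) (a m) * C j m))"
    by (subst gram_det_eq_ldet, rule ldet_cong) (rule ip)
  also have "\<dots> = ldet k C * ldet k (\<lambda>l j. \<Sum>m=1..k. ip (a l) (a m) * C j m)"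
    by (rule ldet_mult)
  also have "\<dots> = ldet k C * (ldet k (\<lambda>l m. ip (a l) (a m)) * ldet k (\<lambda>m j. C j m))"
    by (subst ldet_mult) simp
  also have "ldet k (\<lambda>m j. C j m) = ldet k C"
    by (rule ldet_transpose)
  finally show ?thesis
    by (simp add: gram_det_eq_ldet[of ip k a] power2_eq_square mult_ac)
qed

text \<open>
  A real change of basis multiplies the Gram determinants of all real bilinear forms on the space,
  real or complex valued, by one and the same factor. This is what makes ratios such as
  \<open>\<parallel>P B\<parallel> / \<parallel>B\<parallel>\<close> independent of the basis.
\<close>
lemma gram_det_linear_combination:
  fixes ip :: "'a::real_vector \<Rightarrow> 'a \<Rightarrow> 'k::{real_algebra_1,comm_ring_1}"
  assumes ip: "bilinear ip" and x: "\<And>i. i \<in> {1..k} \<Longrightarrow> x i = (\<Sum>l=1..k. C i l *\<^sub>R a l)"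
  shows "gram_det ip k x = of_real ((ldet k C)\<^sup>2) * gram_det ip k a"
proof -
  have "gram_det ip k x = (ldet k (\<lambda>i j. of_real (C i j)))\<^sup>2 * gram_det ip k a"
  proof (rule gram_det_change_of_basis)
    fix i j assume "i \<in> {1..k}" "j \<in> {1..k}"
    then have "ip (x i) (x j) = (\<Sum>l=1..k. \<Sum>m=1..k. ip (C i l *\<^sub>R a l) (C j m *\<^sub>R a m))"
      by (simp only: x bilinear_sum[OF ip] sum.cartesian_product)
    also have "\<dots> = (\<Sum>l=1..k. of_real (C i l) * (\<Sum>m=1..k. ip (a l) (a m) * of_real (C j m)))"
      unfolding sum_distrib_left
      by (simp add: bilinear_lmul[OF ip] bilinear_rmul[OF ip] scaleR_conv_of_real mult_ac)
    finally show "ip (x i) (x j) =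
        (\<Sum>l=1..k. of_real (C i l) * (\<Sum>m=1..k. ip (a l) (a m) * of_real (C j m)))" .
  qed
  then show ?thesis by (simp add: ldet_of_real)
qed


section \<open>Orthonormal bases\<close>

lemma orthonormal_basisI:
  assumes V: "subspace V" and mem: "\<And>j. j \<in> {1..dim V} \<Longrightarrow> a j \<in> V"
    and on: "\<And>j k. j \<in> {1..dim V} \<Longrightarrow> k \<in> {1..dim V} \<Longrightarrow> a j \<bullet> a k = (if j = k then 1 else 0)"
  shows "orthonormal_basis V a"
proof -
  let ?I = "{1..dim V}"
  have nz: "a j \<noteq> 0" if "j \<in> ?I" for j
    using on[OF that that] by auto
  have inj: "inj_on a ?I"
    by (rule inj_onI) (metis on zero_neq_one)
  have "pairwise orthogonal (a ` ?I)"
    unfolding pairwise_def orthogonal_def using on by auto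
  then have ind: "independent (a ` ?I)"
    by (rule pairwise_orthogonal_independent) (use nz in auto)
  have sub: "a ` ?I \<subseteq> V" using mem by auto
  have "V \<subseteq> span (a ` ?I)"
    by (rule card_ge_dim_independent[OF sub ind]) (use card_image[OF inj] in simp)
  moreover have "span (a ` ?I) \<subseteq> V"
    using sub V by (rule span_minimal)
  ultimately show ?thesis
    using on by (auto simp: orthonormal_basis_def)
qed

lemma orthonormal_basis_inner:
  "orthonormal_basis V a \<Longrightarrow> j \<in> {1..dim V} \<Longrightarrow> k \<in> {1..dim V} \<Longrightarrow>
    a j \<bullet> a k = (if j = k then 1 else 0)"
  by (simp add: orthonormal_basis_def)

lemma orthonormal_basis_mem:
  "orthonormal_basis V a \<Longrightarrow> j \<in> {1..dim V} \<Longrightarrow> a j \<in> V"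
  by (metis orthonormal_basis_def imageI span_base)

lemma subspace_orthonormal_basis: "orthonormal_basis V a \<Longrightarrow> subspace V"
  unfolding orthonormal_basis_def by (metis subspace_span)

lemma orthonormal_basis_expansion:
  assumes a: "orthonormal_basis V a" and x: "x \<in> V"
  shows "x = (\<Sum>k=1..dim V. (x \<bullet> a k) *\<^sub>R a k)"
proof -
  let ?I = "{1..dim V}"
  have V: "subspace V"
    by (rule subspace_orthonormal_basis[OF a])
  define y where "y = x - (\<Sum>k\<in>?I. (x \<bullet> a k) *\<^sub>R a k)"
  have "y \<bullet> a j = 0" if j: "j \<in> ?I" for j
  proof -
    have "(\<Sum>k\<in>?I. (x \<bullet> a k) * (a k \<bullet> a j)) = (\<Sum>k\<in>?I. if k = j then x \<bullet> a k else 0)"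
      by (intro sum.cong) (auto simp: orthonormal_basis_inner[OF a _ j])
    then show ?thesis
      using j by (simp add: y_def inner_diff_left inner_sum_left)
  qed
  moreover have "y \<in> span (a ` ?I)"
    using a x V orthonormal_basis_mem[OF a]
    by (auto simp: y_def orthonormal_basis_def intro!: subspace_diff subspace_sum subspace_scale)
  ultimately have "orthogonal y y"
    by (intro orthogonal_to_span[of y "a ` ?I" y]) (auto simp: orthogonal_def)
  then show ?thesis by (simp add: y_def orthogonal_def)
qed

lemma orthonormal_basis_Parseval:
  assumes a: "orthonormal_basis V a" and x: "x \<in> V"
  shows "x \<bullet> y = (\<Sum>k=1..dim V. (x \<bullet> a k) * (y \<bullet> a k))"
proof -
  have "x \<bullet> y = (\<Sum>k=1..dim V. (x \<bullet> a k) *\<^sub>R a k) \<bullet> y"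
    by (rule arg_cong[OF orthonormal_basis_expansion[OF a x]])
  also have "\<dots> = (\<Sum>k=1..dim V. (x \<bullet> a k) * (y \<bullet> a k))"
    by (simp add: inner_sum_left inner_commute[of y])
  finally show ?thesis .
qed

text \<open>
  Both sides are the inner product of the orthogonal projections of \<open>x\<close> and \<open>y\<close> to \<open>W\<close>.
\<close>
lemma orthonormal_basis_projection_unique:
  assumes b: "orthonormal_basis W b" and c: "orthonormal_basis W c"
  shows "(\<Sum>l=1..dim W. (x \<bullet> b l) * (y \<bullet> b l)) = (\<Sum>l=1..dim W. (x \<bullet> c l) * (y \<bullet> c l))"
proof -
  define z where "z = (\<Sum>l=1..dim W. (x \<bullet> b l) *\<^sub>R b l)"
  have W: "subspace W"
    by (rule subspace_orthonormal_basis[OF b])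
  have zW: "z \<in> W"
    unfolding z_def using W orthonormal_basis_mem[OF b] by (intro subspace_sum subspace_scale)
  have zx: "z \<bullet> w = x \<bullet> w" if "w \<in> W" for w
    using orthonormal_basis_Parseval[OF b that, of x]
    by (simp add: z_def inner_sum_right inner_commute[of _ w] mult.commute)
  have "(\<Sum>l=1..dim W. (x \<bullet> b l) * (y \<bullet> b l)) = z \<bullet> y"
    by (simp add: z_def inner_sum_left inner_commute[of y])
  also have "\<dots> = (\<Sum>l=1..dim W. (z \<bullet> c l) * (y \<bullet> c l))"
    by (rule orthonormal_basis_Parseval[OF c zW])
  also have "\<dots> = (\<Sum>l=1..dim W. (x \<bullet> c l) * (y \<bullet> c l))"
    by (intro sum.cong refl) (simp add: zx orthonormal_basis_mem[OF c])
  finally show ?thesis .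
qed

lemma gram_det_orthonormal: 
  assumes "orthonormal_basis V a"
  shows "gram_det (\<bullet>) (dim V) a = 1"
proof -
  have "gram_det (\<bullet>) (dim V) a = ldet (dim V) (\<lambda>j k. if j = k then 1 else 0)"
    by (subst gram_det_eq_ldet, rule ldet_cong) (rule orthonormal_basis_inner[OF assms])
  then show ?thesis by (simp add: ldet_diag)
qed

lemma is_basis_of_orthonormal:
  assumes "orthonormal_basis V a"
  shows "is_basis V a"
proof -
  have V: "span (a ` {1..dim V}) = V"
    using assms by (simp add: orthonormal_basis_def)
  have inj: "inj_on a {1..dim V}"
    by (rule inj_onI) (metis orthonormal_basis_inner[OF assms] zero_neq_one)
  have "independent (a ` {1..dim V})"
  proof (rule card_le_dim_spanning)
    show "a ` {1..dim V} \<subseteq> V"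
      using orthonormal_basis_mem[OF assms] by blast
    show "card (a ` {1..dim V}) \<le> dim V"
      using card_image[OF inj] by simp
  qed (use V in auto)
  then show ?thesis
    using inj V by (simp add: is_basis_def)
qed

lemma is_basis_coefficients:
  assumes e: "is_basis V e" and x: "x \<in> V"
  shows "\<exists>C. x = (\<Sum>l=1..dim V. C l *\<^sub>R e l)"
proof -
  have "x \<in> span (e ` {1..dim V})" and inj: "inj_on e {1..dim V}"
    using e x by (simp_all add: is_basis_def)
  then obtain u where "x = (\<Sum>w\<in>e ` {1..dim V}. u w *\<^sub>R w)"
    by (auto simp: span_finite)
  also have "\<dots> = (\<Sum>l=1..dim V. u (e l) *\<^sub>R e l)"
    by (rule sum.reindex[OF inj, unfolded o_def])
  finally show ?thesis by (intro exI)
qed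

lemma bilinear_inner_linear:
  assumes f: "linear f"
  shows "bilinear (\<lambda>x y. f x \<bullet> f y)"
  unfolding bilinear_def
  by (auto intro!: linearI simp: linear_add[OF f] linear_scale[OF f] inner_add_left inner_add_right)

text \<open>
  Applied to \<open>f = P\<close>, the projection to the orthogonal complement, this computes the ratio
  \<open>\<parallel>P B\<parallel> / \<parallel>B\<parallel>\<close> in an orthonormal basis instead of the given one.
\<close>
lemma gram_det_basis:
  fixes f :: "'a::euclidean_space \<Rightarrow> 'a"
  assumes a: "orthonormal_basis V a" and e: "is_basis V e"
  shows "gram_det (\<bullet>) (dim V) e > 0"
    and "linear f \<Longrightarrow> gram_det (\<bullet>) (dim V) (\<lambda>j. f (e j)) =
      gram_det (\<bullet>) (dim V) e * gram_det (\<bullet>) (dim V) (\<lambda>j. f (a j))"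
proof -
  let ?d = "dim V"
  define C where "C j l = e j \<bullet> a l" for j l
  have eV: "e j \<in> V" if "j \<in> {1..?d}" for j
    using e that by (metis is_basis_def imageI span_base)
  have e_a: "e j = (\<Sum>l=1..?d. C j l *\<^sub>R a l)" if "j \<in> {1..?d}" for j
    unfolding C_def by (rule orthonormal_basis_expansion[OF a eV[OF that]])
  have gf: "gram_det (\<bullet>) ?d (\<lambda>j. f (e j)) = (ldet ?d C)\<^sup>2 * gram_det (\<bullet>) ?d (\<lambda>j. f (a j))"
    if "linear f" for f :: "'a \<Rightarrow> 'a"
    using gram_det_linear_combination[OF bilinear_inner_linear[OF that] e_a]
    by (simp add: gram_det_def)
  have g: "gram_det (\<bullet>) ?d e = (ldet ?d C)\<^sup>2"
    using gf[OF linear_id] by (simp add: gram_det_orthonormal[OF a])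
  \<comment> \<open>an inverse change of basis shows that the determinant of \<open>C\<close> does not vanish\<close>
  obtain D where D: "\<And>j. j \<in> {1..?d} \<Longrightarrow> a j = (\<Sum>l=1..?d. D j l *\<^sub>R e l)"
    using is_basis_coefficients[OF e orthonormal_basis_mem[OF a]] by metis
  have "gram_det (\<bullet>) ?d a = (ldet ?d D)\<^sup>2 * gram_det (\<bullet>) ?d e"
    using gram_det_linear_combination[OF bilinear_inner_linear[OF linear_id] D]
    by (simp add: gram_det_def)
  then have "gram_det (\<bullet>) ?d e \<noteq> 0"
    by (auto simp: gram_det_orthonormal[OF a])
  then show "gram_det (\<bullet>) ?d e > 0"
    unfolding g by simp
  show "gram_det (\<bullet>) ?d (\<lambda>j. f (e j)) = gram_det (\<bullet>) ?d e * gram_det (\<bullet>) ?d (\<lambda>j. f (a j))" if "linear f"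
    using gf[OF that] g by simp
qed


section \<open>Principal bases\<close>

lemma dim_orthogonal_hyperplane:
  fixes V :: "'a::euclidean_space set"
  assumes V: "subspace V" and a: "a \<in> V" "a \<noteq> 0"
  shows "dim V = Suc (dim {x \<in> V. a \<bullet> x = 0})"
proof -
  have "dim {y \<in> V. \<forall>x\<in>span {a}. orthogonal x y} + dim (span {a}) = dim V"
    using V a by (intro dim_subspace_orthogonal_to_vectors subspace_span span_minimal) auto
  moreover have "{y \<in> V. \<forall>x\<in>span {a}. orthogonal x y} = {x \<in> V. a \<bullet> x = 0}"
    by (auto simp: orthogonal_def span_singleton)
  moreover have "dim (span {a}) = 1"
    using a by simp
  ultimately show ?thesis by simp
qed

lemma subspace_orthogonal_hyperplane:
  "subspace V \<Longrightarrow> subspace {x \<in> V. a \<bullet> x = 0}"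
  by (auto simp: subspace_def inner_add_right)

lemma best_approximating_pair:
  fixes V W :: "'a::euclidean_space set"
  assumes V: "subspace V" and W: "subspace W" and nz: "dim V \<noteq> 0" "dim W \<noteq> 0"
  obtains a b where "a \<in> V" "norm a = 1" "b \<in> W" "norm b = 1"
    "\<And>x y. x \<in> V \<Longrightarrow> y \<in> W \<Longrightarrow> x \<bullet> y \<le> (a \<bullet> b) * norm x * norm y"
proof -
  have unit: "\<exists>u. u \<in> U \<and> norm u = 1" if U: "subspace U" "dim U \<noteq> 0" for U :: "'a set"
  proof -
    obtain x where "x \<in> U" "x \<noteq> 0"
      using U by (auto simp: dim_eq_0)
    then show ?thesis
      using U by (intro exI[of _ "x /\<^sub>R norm x"]) (auto simp: subspace_scale)
  qed
  \<comment> \<open>the maximum of the inner product over the compact product of the two unit spheres\<close>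
  let ?S = "(V \<inter> sphere 0 1) \<times> (W \<inter> sphere 0 1)"
  have "compact ?S"
    using V W by (intro compact_Times closed_Int_compact closed_subspace) auto
  moreover have "?S \<noteq> {}"
    using unit[OF V nz(1)] unit[OF W nz(2)] by auto
  moreover have "continuous_on ?S (\<lambda>(x, y). x \<bullet> y)"
    by (auto simp: case_prod_unfold intro!: continuous_intros)
  ultimately have "\<exists>z\<in>?S. \<forall>z'\<in>?S. (\<lambda>(x, y). x \<bullet> y) z' \<le> (\<lambda>(x, y). x \<bullet> y) z"
    by (rule continuous_attains_sup)
  then obtain z where z: "z \<in> ?S"
    "\<And>z'. z' \<in> ?S \<Longrightarrow> (case z' of (x, y) \<Rightarrow> x \<bullet> y) \<le> (case z of (x, y) \<Rightarrow> x \<bullet> y)"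
    by (elim bexE) (erule that, erule bspec)
  obtain a b where ab: "z = (a, b)" by (cases z)
  show ?thesis
  proof (rule that[of a b])
    fix x y assume xy: "x \<in> V" "y \<in> W"
    show "x \<bullet> y \<le> (a \<bullet> b) * norm x * norm y"
    proof (cases "x = 0 \<or> y = 0")
      case False
      have "(x /\<^sub>R norm x, y /\<^sub>R norm y) \<in> ?S"
        using xy V W False by (auto simp: subspace_scale)
      from z(2)[OF this] False show ?thesis
        by (simp add: ab field_simps)
    qed auto
  qed (use z(1) ab in auto)
qed

text \<open>
  The first principal vector \<open>a\<close> projects to a multiple of its partner \<open>b\<close>: a component of
  \<open>a\<close> along a further direction of \<open>W\<close> would give a unit vector of \<open>W\<close> closer to \<open>a\<close>.
\<close>
lemma maximal_pair_orthogonal: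
  fixes a b w :: "'a::euclidean_space"
  assumes W: "subspace W" and b: "b \<in> W" "norm b = 1" 
    and max: "\<And>y. y \<in> W \<Longrightarrow> a \<bullet> y \<le> (a \<bullet> b) * norm y"
    and w: "w \<in> W" "b \<bullet> w = 0"
  shows "a \<bullet> w = 0"
proof (cases "w = 0")
  case False
  define u where "u = w /\<^sub>R norm w"
  have u: "u \<in> W" "u \<bullet> u = 1" "b \<bullet> u = 0"
    using w False W by (auto simp: u_def subspace_scale dot_square_norm power2_eq_square)
  have bb: "b \<bullet> b = 1" using b by (simp add: dot_square_norm)
  \<comment> \<open>the vector on which \<open>a\<close> is largest among all vectors of the plane of \<open>b\<close> and \<open>u\<close> of the
    same length: it is the projection of \<open>a\<close> to that plane\<close>
  define y where "y = (a \<bullet> b) *\<^sub>R b + (a \<bullet> u) *\<^sub>R u"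
  define N where "N = (a \<bullet> b)\<^sup>2 + (a \<bullet> u)\<^sup>2"
  have "a \<bullet> y = N"
    by (simp add: y_def N_def inner_add_right power2_eq_square)
  moreover have "(norm y)\<^sup>2 = N"
    unfolding power2_norm_eq_inner using u bb
    by (simp add: y_def N_def inner_add_left inner_add_right power2_eq_square inner_commute[of u b])
  moreover have "y \<in> W"
    using W b u by (simp add: y_def subspace_add subspace_scale)
  ultimately have le: "(norm y)\<^sup>2 \<le> (a \<bullet> b) * norm y" and eq: "(norm y)\<^sup>2 = N"
    using max[of y] by auto
  have "norm y \<le> \<bar>a \<bullet> b\<bar>"
  proof (cases "norm y = 0")
    case False
    then have "norm y \<le> a \<bullet> b"
      using le by (simp add: power2_eq_square)
    then show ?thesis by simp
  qed auto
  then have "(norm y)\<^sup>2 \<le> (a \<bullet> b)\<^sup>2"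
    by (metis abs_le_square_iff abs_norm_cancel)
  then have "a \<bullet> u = 0"
    using eq by (simp add: N_def)
  then show ?thesis
    using False by (simp add: u_def)
qed auto

text \<open>
  Meant for subspaces of equal dimension. The angles enter through their cosines only, so that
  increasing angles in \<open>[0, \<pi>/2]\<close> become decreasing nonnegative inner products.
\<close>
definition principal_bases :: "'a::euclidean_space set \<Rightarrow> 'a set \<Rightarrow> (nat \<Rightarrow> 'a) \<Rightarrow> (nat \<Rightarrow> 'a) \<Rightarrow> bool" where
  "principal_bases V W a b \<longleftrightarrow> orthonormal_basis V a \<and> orthonormal_basis W b \<and>
    (\<forall>j\<in>{1..dim V}. \<forall>k\<in>{1..dim V}. j \<noteq> k \<longrightarrow> a j \<bullet> b k = 0) \<and>
    (\<forall>j\<in>{1..dim V}. 0 \<le> a j \<bullet> b j) \<and>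
    (\<forall>j\<in>{1..dim V}. \<forall>k\<in>{1..dim V}. j \<le> k \<longrightarrow> a k \<bullet> b k \<le> a j \<bullet> b j)"

lemma principal_basesD:
  assumes "principal_bases V W a b"
  shows "orthonormal_basis V a" "orthonormal_basis W b"
    and "\<And>j k. j \<in> {1..dim V} \<Longrightarrow> k \<in> {1..dim V} \<Longrightarrow> j \<noteq> k \<Longrightarrow> a j \<bullet> b k = 0"
    and "\<And>j. j \<in> {1..dim V} \<Longrightarrow> 0 \<le> a j \<bullet> b j"
    and "\<And>j k. j \<in> {1..dim V} \<Longrightarrow> k \<in> {1..dim V} \<Longrightarrow> j \<le> k \<Longrightarrow> a k \<bullet> b k \<le> a j \<bullet> b j"
  using assms by (simp_all add: principal_bases_def)

text \<open>
  The singular value decomposition of the projection of \<open>V\<close> to \<open>W\<close>, by induction on the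
  dimension: a pair of unit vectors with maximal inner product is split off, and the induction
  hypothesis applies to its orthogonal complements in \<open>V\<close> and \<open>W\<close>.
\<close>
lemma principal_bases_exist:
  fixes V W :: "'a::euclidean_space set"
  assumes "subspace V" "subspace W" "dim V = d" "dim W = d"
  shows "\<exists>a b. principal_bases V W a b"
  using assms
proof (induction d arbitrary: V W)
  case 0
  then show ?case
    by (intro exI[of _ "\<lambda>_. 0"]) (auto simp: principal_bases_def intro!: orthonormal_basisI)
next
  case (Suc d)
  note V = \<open>subspace V\<close> and W = \<open>subspace W\<close>
  obtain a\<^sub>1 b\<^sub>1 where a\<^sub>1: "a\<^sub>1 \<in> V" "norm a\<^sub>1 = 1" and b\<^sub>1: "b\<^sub>1 \<in> W" "norm b\<^sub>1 = 1"
    and max: "\<And>x y. x \<in> V \<Longrightarrow> y \<in> W \<Longrightarrow> x \<bullet> y \<le> (a\<^sub>1 \<bullet> b\<^sub>1) * norm x * norm y"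
    using best_approximating_pair[OF V W] Suc.prems by auto
  have nn: "0 \<le> a\<^sub>1 \<bullet> b\<^sub>1"
    using max[of "- a\<^sub>1" b\<^sub>1] a\<^sub>1 b\<^sub>1 V by (simp add: subspace_neg)
  let ?V = "{x \<in> V. a\<^sub>1 \<bullet> x = 0}" and ?W = "{y \<in> W. b\<^sub>1 \<bullet> y = 0}"
  have "a\<^sub>1 \<noteq> 0" "b\<^sub>1 \<noteq> 0" using a\<^sub>1 b\<^sub>1 by auto
  then have dims: "dim ?V = d" "dim ?W = d"
    using dim_orthogonal_hyperplane[OF V a\<^sub>1(1)] dim_orthogonal_hyperplane[OF W b\<^sub>1(1)] Suc.prems by auto
  obtain a b where ab: "principal_bases ?V ?W a b"
    using Suc.IH[OF subspace_orthogonal_hyperplane[OF V] subspace_orthogonal_hyperplane[OF W] dims]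
    by (elim exE)
  note a = principal_basesD(1)[OF ab] and b = principal_basesD(2)[OF ab]
    and off = principal_basesD(3)[OF ab, unfolded dims]
    and nn' = principal_basesD(4)[OF ab, unfolded dims]
    and mono = principal_basesD(5)[OF ab, unfolded dims]
  have aV: "a j \<in> V" "a\<^sub>1 \<bullet> a j = 0" and bW: "b j \<in> W" "b\<^sub>1 \<bullet> b j = 0" if "j \<in> {1..d}" for j
    using orthonormal_basis_mem[OF a, of j] orthonormal_basis_mem[OF b, of j] that dims by auto
  have a1b: "a\<^sub>1 \<bullet> b j = 0" and ab1: "a j \<bullet> b\<^sub>1 = 0" if "j \<in> {1..d}" for j
  proof -
    show "a\<^sub>1 \<bullet> b j = 0"
      by (rule maximal_pair_orthogonal[OF W b\<^sub>1 _ bW[OF that]]) (use max[OF a\<^sub>1(1)] a\<^sub>1 in auto)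
    have "b\<^sub>1 \<bullet> a j = 0"
      by (rule maximal_pair_orthogonal[OF V a\<^sub>1 _ aV[OF that]])
        (use max[OF _ b\<^sub>1(1)] b\<^sub>1 in \<open>auto simp: inner_commute\<close>)
    then show "a j \<bullet> b\<^sub>1 = 0" by (simp add: inner_commute)
  qed
  note ona = orthonormal_basis_inner[OF a, unfolded dims]
    and onb = orthonormal_basis_inner[OF b, unfolded dims]
  have first: "a j \<bullet> b j \<le> a\<^sub>1 \<bullet> b\<^sub>1" if "j \<in> {1..d}" for j
    using max[OF aV(1)[OF that] bW(1)[OF that]] ona[OF that that] onb[OF that that]
    by (simp add: norm_eq_sqrt_inner)
  \<comment> \<open>the maximal pair becomes the first one, the pairs of the complements move up by one place\<close>
  define a' where "a' j = (if j = 1 then a\<^sub>1 else a (j - 1))" for j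
  define b' where "b' j = (if j = 1 then b\<^sub>1 else b (j - 1))" for j
  have a'1: "a' 1 = a\<^sub>1" "b' 1 = b\<^sub>1"
    by (simp_all add: a'_def b'_def)
  have a'S: "a' (Suc j) = a j" "b' (Suc j) = b j" if "j \<in> {1..d}" for j
    using that by (simp_all add: a'_def b'_def)
  have index: "j = 1 \<or> (\<exists>i\<in>{1..d}. j = Suc i)" if "j \<in> {1..Suc d}" for j
    using that by (cases j) auto
  have eq1: "a\<^sub>1 \<bullet> a\<^sub>1 = 1" "b\<^sub>1 \<bullet> b\<^sub>1 = 1"
    using a\<^sub>1 b\<^sub>1 by (simp_all add: norm_eq_1)
  have aa1: "a j \<bullet> a\<^sub>1 = 0" "b j \<bullet> b\<^sub>1 = 0" if "j \<in> {1..d}" for j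
    using aV(2)[OF that] bW(2)[OF that] by (simp_all add: inner_commute)
  have "orthonormal_basis V a'"
  proof (rule orthonormal_basisI[OF V], unfold \<open>dim V = Suc d\<close>)
    show "a' j \<in> V" if "j \<in> {1..Suc d}" for j
      using index[OF that] a\<^sub>1(1) aV(1) by (elim disjE bexE) (simp_all only: a'1 a'S)
    show "a' j \<bullet> a' k = (if j = k then 1 else 0)" if "j \<in> {1..Suc d}" "k \<in> {1..Suc d}" for j k
      using index[OF that(1)] index[OF that(2)]
      by (elim disjE bexE) (simp_all only: a'1 a'S eq1 aa1 ona aV(2), auto?)
  qed
  moreover have "orthonormal_basis W b'"
  proof (rule orthonormal_basisI[OF W], unfold \<open>dim W = Suc d\<close>)
    show "b' j \<in> W" if "j \<in> {1..Suc d}" for j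
      using index[OF that] b\<^sub>1(1) bW(1) by (elim disjE bexE) (simp_all only: a'1 a'S)
    show "b' j \<bullet> b' k = (if j = k then 1 else 0)" if "j \<in> {1..Suc d}" "k \<in> {1..Suc d}" for j k
      using index[OF that(1)] index[OF that(2)]
      by (elim disjE bexE) (simp_all only: a'1 a'S eq1 aa1 onb bW(2), auto?)
  qed
  moreover have "a' j \<bullet> b' k = 0" if "j \<in> {1..Suc d}" "k \<in> {1..Suc d}" "j \<noteq> k" for j k
    using index[OF that(1)] index[OF that(2)] that(3) by (metis a'1 a'S a1b ab1 off)
  moreover have "0 \<le> a' j \<bullet> b' j" if "j \<in> {1..Suc d}" for j
    using index[OF that] by (metis a'1 a'S nn nn')
  moreover have "a' k \<bullet> b' k \<le> a' j \<bullet> b' j" if jk: "j \<in> {1..Suc d}" "k \<in> {1..Suc d}" "j \<le> k" for j k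
  proof (cases "j = 1")
    case True
    then show ?thesis
      using index[OF jk(2)] by (metis a'1 a'S first order.refl)
  next
    case False
    then obtain i l where "i \<in> {1..d}" "j = Suc i" "l \<in> {1..d}" "k = Suc l"
      using index[OF jk(1)] index[OF jk(2)] jk(3) by fastforce
    then show ?thesis
      using mono[of i l] jk(3) by (simp only: a'S Suc_le_mono)
  qed
  ultimately have "principal_bases V W a' b'"
    unfolding principal_bases_def \<open>dim V = Suc d\<close> by (intro conjI ballI impI)
  then show ?case by (intro exI)
qed

text \<open>
  Existence of principal bases guarantees that the choice in the definition of
  \<open>principal_angle\<close> picks a family of principal angles.
\<close>
lemma principal_angle_cos:
  fixes V W :: "'a::euclidean_space set"
  assumes V: "subspace V" and W: "subspace W" and dim: "dim W = dim V"
  obtains a b where "principal_bases V W a b"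
    "\<forall>j\<in>{1..dim V}. 0 \<le> principal_angle V W j \<and> principal_angle V W j \<le> pi / 2"
    "\<forall>j\<in>{1..dim V}. a j \<bullet> b j = cos (principal_angle V W j)"
proof -
  let ?d = "dim V"
  have "\<exists>\<theta>. are_principal_angles V W \<theta>"
  proof -
    obtain a b where ab: "principal_bases V W a b"
      using principal_bases_exist[OF V W refl dim] by (elim exE)
    note a = principal_basesD(1)[OF ab] and b = principal_basesD(2)[OF ab]
    have le1: "a j \<bullet> b j \<le> 1" if "j \<in> {1..?d}" for j
      using norm_cauchy_schwarz[of "a j" "b j"] orthonormal_basis_inner[OF a, of j j]
        orthonormal_basis_inner[OF b, of j j] that
      by (simp add: norm_eq_sqrt_inner dim)
    have ge0: "0 \<le> a j \<bullet> b j" if "j \<in> {1..?d}" for j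
      by (rule principal_basesD(4)[OF ab that])
    have "are_principal_angles V W (\<lambda>j. arccos (a j \<bullet> b j))"
      unfolding are_principal_angles_def Let_def dim min.idem
    proof (intro conjI ballI impI exI)
      fix j assume j: "j \<in> {1..?d}"
      show "0 \<le> arccos (a j \<bullet> b j)"
        using le1[OF j] ge0[OF j] by (intro arccos_lbound) auto
      show "arccos (a j \<bullet> b j) \<le> pi / 2"
        using le1[OF j] ge0[OF j] by (intro arccos_le_pi2)
      show "a j \<bullet> b j = cos (arccos (a j \<bullet> b j))"
        using le1[OF j] ge0[OF j] by simp
    next
      fix j k assume jk: "j \<in> {1..?d}" "k \<in> {1..?d}" "j \<le> k"
      show "arccos (a j \<bullet> b j) \<le> arccos (a k \<bullet> b k)"
        using principal_basesD(5)[OF ab jk] le1[OF jk(1)] ge0[OF jk(2)]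
        by (intro arccos_le_arccos) auto
    qed (use a b principal_basesD(3)[OF ab] in auto)
    then show ?thesis by (intro exI)
  qed
  then have "are_principal_angles V W (principal_angle V W)"
    unfolding principal_angle_def by (rule someI_ex)
  moreover define \<theta> where "\<theta> = principal_angle V W"
  ultimately have "are_principal_angles V W \<theta>" by simp
  note \<theta> = this[unfolded are_principal_angles_def Let_def dim min.idem]
  have range: "\<forall>j\<in>{1..?d}. 0 \<le> \<theta> j \<and> \<theta> j \<le> pi / 2"
    by (rule conjunct1[OF \<theta>])
  have mono: "\<theta> j \<le> \<theta> k" if "j \<in> {1..?d}" "k \<in> {1..?d}" "j \<le> k" for j k
    using conjunct1[OF conjunct2[OF \<theta>]] that by (elim ballE impE) auto
  obtain a b where a: "orthonormal_basis V a" and b: "orthonormal_basis W b"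
    and off: "\<forall>j\<in>{1..?d}. \<forall>k\<in>{1..?d}. j \<noteq> k \<longrightarrow> a j \<bullet> b k = 0"
    and cos: "\<forall>j\<in>{1..?d}. a j \<bullet> b j = cos (\<theta> j)"
    using conjunct2[OF conjunct2[OF \<theta>]] by (elim exE conjE)
  have "principal_bases V W a b"
    unfolding principal_bases_def
  proof (intro conjI ballI impI a b)
    fix j assume j: "j \<in> {1..?d}"
    show "0 \<le> a j \<bullet> b j"
      using bspec[OF range j] by (simp add: bspec[OF cos j] cos_ge_zero)
  next
    fix j k assume jk: "j \<in> {1..?d}" "k \<in> {1..?d}"
    {
      assume "j \<noteq> k"
      then show "a j \<bullet> b k = 0"
        using bspec[OF bspec[OF off jk(1)] jk(2)] by simp
    }
    {
      assume "j \<le> k"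
      then show "a k \<bullet> b k \<le> a j \<bullet> b j"
        unfolding bspec[OF cos jk(1)] bspec[OF cos jk(2)]
        using bspec[OF range jk(1)] bspec[OF range jk(2)] mono[OF jk]
        by (intro cos_monotone_0_pi_le) auto
    }
  qed
  then show ?thesis
    using range cos unfolding \<theta>_def by (rule that)
qed


section \<open>Multiplication by the imaginary unit\<close>

lemma inner_imult: "(\<i> *s x) \<bullet> y = - (x \<bullet> (\<i> *s y))" for x y :: "complex^'n"
  by (simp add: inner_vec_def inner_complex_def sum_negf[symmetric])

lemma inner_imult_imult: "(\<i> *s x) \<bullet> (\<i> *s y) = x \<bullet> y" for x y :: "complex^'n"
  by (simp add: inner_vec_def inner_complex_def add.commute)

lemma imult_imult: "\<i> *s (\<i> *s x) = - x" for x :: "complex^'n"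
  by (simp add: vec_eq_iff)

lemma linear_imult: "linear ((*s) \<i> :: complex^'n \<Rightarrow> complex^'n)"
  by (rule linearI) (simp_all add: vec_eq_iff distrib_left)

text \<open>
  The imaginary part of the Hermitian product is the real inner product with a vector turned
  by \<open>\<i>\<close>; this ties the complex Gram matrix to the position of \<open>\<i>V\<close>.
\<close>
lemma herm_eq_inner:
  "herm x y = complex_of_real (x \<bullet> y) + \<i> * complex_of_real (x \<bullet> (\<i> *s y))"
  by (rule complex_eqI) (simp_all add: herm_def inner_vec_def inner_complex_def algebra_simps)

lemma bilinear_herm: "bilinear (herm :: complex^'n \<Rightarrow> complex^'n \<Rightarrow> complex)"
  unfolding bilinear_def
  by (auto intro!: linearI simp: herm_def sum.distrib distrib_left distrib_right scaleR_sum_right)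

lemma subspace_imult: "subspace V \<Longrightarrow> subspace (imult V)"
  unfolding imult_def by (rule linear_subspace_image[OF linear_imult])

lemma dim_imult: "dim (imult V) = dim V"
proof -
  have "inj_on ((*s) \<i>) (span V)"
    by (rule inj_onI) (simp add: vec_eq_iff)
  then show ?thesis
    unfolding imult_def by (rule dim_image_eq[OF linear_imult])
qed


section \<open>Pairing of the Kaehler angles\<close>

text \<open>
  The reason why principal angles of \<open>V\<close> and \<open>\<i>V\<close> come in pairs. Write \<open>b k = \<i> c k\<close>
  with an orthonormal basis \<open>c\<close> of \<open>V\<close>, let \<open>M k l = \<langle>a k, c l\<rangle>\<close> and let \<open>s k\<close> be the
  cosine with number \<open>k\<close>. Multiplication by \<open>\<i>\<close> is skew-adjoint, and this yields
  \<open>s k M k l = - s l M l k\<close> and \<open>s k M l k = - s l M k l\<close>. So \<open>M k l\<close> vanishes unless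
  \<open>s k = s l\<close>, and \<open>M\<close> is skew-symmetric on a block where all cosines are positive. If the
  cosine drops after the index \<open>m\<close>, the block of the first \<open>m\<close> indices is therefore both
  orthogonal and skew-symmetric. Its determinant \<open>D\<close> satisfies \<open>D \<noteq> 0\<close> and
  \<open>D = (-1)\<^sup>m D\<close>, so \<open>m\<close> is even.
\<close>
lemma large_cosines_even:
  fixes V :: "(complex^'n) set"
  assumes V: "subspace V" and ab: "principal_bases V (imult V) a b"
    and m: "m \<in> {1..dim V}" "0 < a m \<bullet> b m"
    and gap: "m < dim V \<Longrightarrow> a (Suc m) \<bullet> b (Suc m) < a m \<bullet> b m"
  shows "even m"
proof -
  let ?d = "dim V"
  define s where "s k = a k \<bullet> b k" for k
  note a = principal_basesD(1)[OF ab] and b = principal_basesD(2)[OF ab]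
    and off = principal_basesD(3)[OF ab] and nn = principal_basesD(4)[OF ab]
    and mono = principal_basesD(5)[OF ab]
  have ab_s: "a j \<bullet> b k = (if j = k then s k else 0)" if "j \<in> {1..?d}" "k \<in> {1..?d}" for j k
    using off[OF that] by (auto simp: s_def)
  \<comment> \<open>a second orthonormal basis of \<open>V\<close>, with \<open>\<i> *s c k = b k\<close>\<close>
  define c where "c k = - (\<i> *s b k)" for k
  have ic: "\<i> *s c k = b k" for k
    by (simp add: c_def vec_eq_iff)
  have cV: "c k \<in> V" if "k \<in> {1..?d}" for k
  proof -
    have "b k \<in> imult V"
      using orthonormal_basis_mem[OF b, of k] that by (simp add: dim_imult)
    then obtain u where "u \<in> V" "b k = \<i> *s u"
      by (auto simp: imult_def)
    then show ?thesis by (simp add: c_def imult_imult)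
  qed
  have c: "orthonormal_basis V c"
  proof (rule orthonormal_basisI[OF V cV])
    fix j k assume "j \<in> {1..?d}" "k \<in> {1..?d}"
    then show "c j \<bullet> c k = (if j = k then 1 else 0)"
      using orthonormal_basis_inner[OF b, of j k]
      by (simp add: c_def inner_imult_imult dim_imult)
  qed
  \<comment> \<open>the orthogonal matrix between the two bases of \<open>V\<close>; both skewness relations come from
    \<open>\<langle>x, \<i> y\<rangle> = - \<langle>y, \<i> x\<rangle>\<close>, applied once to the \<open>c k\<close> and once to the \<open>a k\<close>\<close>
  define M where "M k l = a k \<bullet> c l" for k l
  have skew1: "s k * M k l = - (s l * M l k)" if kl: "k \<in> {1..?d}" "l \<in> {1..?d}" for k l
  proof -
    have *: "b k \<bullet> c l = s k * M k l" if "k \<in> {1..?d}" "l \<in> {1..?d}" for k l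
    proof -
      have "c l \<bullet> b k = (\<Sum>j=1..?d. (c l \<bullet> a j) * (b k \<bullet> a j))"
        by (rule orthonormal_basis_Parseval[OF a cV[OF that(2)]])
      also have "\<dots> = (\<Sum>j=1..?d. if j = k then (c l \<bullet> a j) * s k else 0)"
        using that ab_s by (intro sum.cong) (auto simp: inner_commute)
      finally show ?thesis
        using that by (simp add: M_def inner_commute)
    qed
    have "b k \<bullet> c l = - (b l \<bullet> c k)"
      using inner_imult[of "c k" "c l"] by (simp add: ic inner_commute)
    then show ?thesis using * kl by simp
  qed
  have skew2: "s k * M l k = - (s l * M k l)" if kl: "k \<in> {1..?d}" "l \<in> {1..?d}" for k l
  proof -
    have *: "a k \<bullet> (\<i> *s a l) = s k * M l k" if "k \<in> {1..?d}" "l \<in> {1..?d}" for k l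
    proof -
      have "\<i> *s a l \<in> imult V"
        using orthonormal_basis_mem[OF a that(2)] by (simp add: imult_def)
      then have "(\<i> *s a l) \<bullet> a k = (\<Sum>j=1..?d. ((\<i> *s a l) \<bullet> b j) * (a k \<bullet> b j))"
        using orthonormal_basis_Parseval[OF b] by (simp add: dim_imult)
      also have "\<dots> = (\<Sum>j=1..?d. if j = k then ((\<i> *s a l) \<bullet> (\<i> *s c j)) * s k else 0)"
        using that ab_s by (intro sum.cong) (auto simp: ic)
      finally show ?thesis
        using that by (simp add: M_def inner_commute inner_imult_imult)
    qed
    have "a k \<bullet> (\<i> *s a l) = - (a l \<bullet> (\<i> *s a k))"
      using inner_imult[of "a k" "a l"] by (simp add: inner_commute)
    then show ?thesis using * kl by simp
  qed
  have eq_level: "(s k)\<^sup>2 * M k l = (s l)\<^sup>2 * M k l" if "k \<in> {1..?d}" "l \<in> {1..?d}" for k l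
  proof -
    have "(s k)\<^sup>2 * M k l = s k * (s k * M k l)"
      by (simp add: power2_eq_square)
    also have "\<dots> = - (s l * (s k * M l k))"
      unfolding skew1[OF that] by simp
    also have "\<dots> = (s l)\<^sup>2 * M k l"
      unfolding skew2[OF that] by (simp add: power2_eq_square)
    finally show ?thesis .
  qed
  have zero: "M k l = 0" if "k \<in> {1..?d}" "l \<in> {1..?d}" "s k \<noteq> s l" for k l
    using eq_level[OF that(1,2)] that(3) nn[OF that(1)] nn[OF that(2)]
    by (auto simp: s_def power2_eq_iff)
  \<comment> \<open>the gap after \<open>m\<close> separates the cosines inside the block from those outside\<close>
  have low: "s l < s k" if "k \<in> {1..m}" "l \<in> {1..?d}" "m < l" for k l
  proof -
    have "s l \<le> s (Suc m)"
      unfolding s_def using that by (intro mono) auto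
    also have "\<dots> < s m"
      unfolding s_def using that by (intro gap) auto
    also have "\<dots> \<le> s k"
      unfolding s_def using that m by (intro mono) auto
    finally show ?thesis .
  qed
  \<comment> \<open>inside the block the common value of \<open>s\<close> is positive and cancels from the skewness relation\<close>
  have skew: "M l k = - M k l" if kl: "k \<in> {1..m}" "l \<in> {1..m}" for k l
  proof (cases "s k = s l")
    case True
    have "s m \<le> s k"
      unfolding s_def using kl m by (intro mono) auto
    then have "s k \<noteq> 0"
      using m by (simp add: s_def)
    moreover have "s k * M l k = - (s k * M k l)"
      using skew2[of k l] kl m True by simp
    ultimately show ?thesis
      by (metis mult_cancel_left mult_minus_right)
  next
    case False
    then show ?thesis using zero[of k l] zero[of l k] kl m by simp
  qed
  have orth: "(\<Sum>l=1..m. M k l * M j l) = (if k = j then 1 else 0)" if "k \<in> {1..m}" "j \<in> {1..m}" for k j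
  proof -
    have kj: "k \<in> {1..?d}" "j \<in> {1..?d}" using that m by auto
    have "(\<Sum>l=1..m. M k l * M j l) = (\<Sum>l=1..?d. M k l * M j l)"
    proof (rule sum.mono_neutral_left)
      show "\<forall>l\<in>{1..?d} - {1..m}. M k l * M j l = 0"
      proof
        fix l assume l: "l \<in> {1..?d} - {1..m}"
        then have "s k \<noteq> s l"
          using low[of k l] that by auto
        then show "M k l * M j l = 0"
          using zero[of k l] l kj by simp
      qed
    qed (use m in auto)
    also have "\<dots> = a k \<bullet> a j"
      unfolding M_def by (rule orthonormal_basis_Parseval[OF c orthonormal_basis_mem[OF a kj(1)], symmetric])
    finally show ?thesis
      by (simp add: orthonormal_basis_inner[OF a kj])
  qed
  have "ldet m M * ldet m M = ldet m (\<lambda>k j. \<Sum>l=1..m. M k l * M j l)"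
    by (subst ldet_mult) (simp only: ldet_transpose[where A = M])
  also have "\<dots> = ldet m (\<lambda>k j. if k = j then 1 else 0)"
    using orth by (rule ldet_cong)
  finally have "ldet m M \<noteq> 0"
    by (auto simp only: ldet_diag prod.neutral_const mult_zero_left zero_neq_one)
  moreover have "ldet m M = (-1) ^ m * ldet m M"
  proof -
    have "ldet m M = ldet m (\<lambda>k l. M l k)"
      by (rule ldet_transpose[symmetric])
    also have "\<dots> = ldet m (\<lambda>k l. - M k l)"
      using skew by (rule ldet_cong)
    also have "\<dots> = (-1) ^ m * ldet m M"
      by (rule ldet_uminus)
    finally show ?thesis .
  qed
  ultimately have "(-1) ^ m = (1 :: real)"
    by (metis mult_cancel_right1)
  then show "even m"
    by (cases "even m") simp_all
qed

text \<open>
  A violation of the pairing would be a drop of the cosine after an odd index, and so would a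
  nonzero last cosine in odd dimension.
\<close>
lemma cosines_paired:
  fixes V :: "(complex^'n) set"
  assumes V: "subspace V" and ab: "principal_bases V (imult V) a b"
  shows "1 \<le> j \<Longrightarrow> 2 * j \<le> dim V \<Longrightarrow> a (2 * j) \<bullet> b (2 * j) = a (2 * j - 1) \<bullet> b (2 * j - 1)"
    and "odd (dim V) \<Longrightarrow> a (dim V) \<bullet> b (dim V) = 0"
proof -
  let ?d = "dim V"
  assume j: "1 \<le> j" "2 * j \<le> ?d"
  let ?m = "2 * j - 1"
  have m: "?m \<in> {1..?d}" "2 * j \<in> {1..?d}" "Suc ?m = 2 * j" "odd ?m" "?m \<le> 2 * j"
    using j by auto
  show "a (2 * j) \<bullet> b (2 * j) = a ?m \<bullet> b ?m"
  proof (rule ccontr)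
    assume "a (2 * j) \<bullet> b (2 * j) \<noteq> a ?m \<bullet> b ?m"
    then have less: "a (2 * j) \<bullet> b (2 * j) < a ?m \<bullet> b ?m"
      using principal_basesD(5)[OF ab m(1,2,5)] by simp
    then have "0 < a ?m \<bullet> b ?m"
      using principal_basesD(4)[OF ab m(2)] by linarith
    then have "even ?m"
      by (rule large_cosines_even[OF V ab m(1)]) (use less in \<open>simp only: m(3)\<close>)
    with m(4) show False by simp
  qed
next
  let ?d = "dim V"
  assume odd: "odd ?d"
  then have d: "?d \<in> {1..?d}" by (auto simp: Suc_le_eq odd_pos)
  then have "\<not> 0 < a ?d \<bullet> b ?d"
    using large_cosines_even[OF V ab d] odd by auto
  then show "a ?d \<bullet> b ?d = 0"
    using principal_basesD(4)[OF ab d] by simp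
qed

lemma prod_pairs:
  fixes f :: "nat \<Rightarrow> 'b::comm_monoid_mult"
  assumes pair: "\<And>j. 1 \<le> j \<Longrightarrow> 2 * j \<le> d \<Longrightarrow> f (2 * j) = f (2 * j - 1)"
    and last: "odd d \<Longrightarrow> f d = 1"
  shows "(\<Prod>j=1..nat \<lceil>real d / 2\<rceil>. f (2 * j - 1))\<^sup>2 = (\<Prod>j=1..d. f j)"
proof -
  have even: "(\<Prod>j=1..2 * h. f j) = (\<Prod>j=1..h. f (2 * j - 1))\<^sup>2" if "2 * h \<le> d" for h
    using that
  proof (induction h)
    case (Suc h)
    then show ?case
      using pair[of "Suc h"] by (simp add: power2_eq_square mult_ac)
  qed simp
  show ?thesis
  proof (cases "even d")
    case True
    then obtain h where "d = 2 * h" by (elim evenE)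
    then show ?thesis using even[of h] by simp
  next
    case False
    then obtain h where h: "d = 2 * h + 1" by (elim oddE)
    \<comment> \<open>the last, unpaired factor of the left-hand side is \<open>f d\<close>\<close>
    have "nat \<lceil>real d / 2\<rceil> = Suc h"
      unfolding h by (simp add: add_divide_distrib) linarith
    then show ?thesis
      using even[of h] last False by (simp add: h power2_eq_square mult_ac)
  qed
qed

text \<open>
  The square repairs the halving in the definition of the holomorphy index: since the angles come
  in pairs, it is the product of the sines of all principal angles.
\<close>
lemma holomorphy_index_squared:
  fixes V :: "(complex^'n) set"
  assumes V: "subspace V"
  obtains a b where "principal_bases V (imult V) a b"
    "(holomorphy_index V)\<^sup>2 = (\<Prod>j=1..dim V. sqrt (1 - (a j \<bullet> b j)\<^sup>2))"
    "\<forall>j\<in>{1..dim V}. (a j \<bullet> b j)\<^sup>2 \<le> 1" "0 \<le> holomorphy_index V"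
proof -
  let ?d = "dim V" and ?\<theta> = "principal_angle V (imult V)"
  obtain a b where ab: "principal_bases V (imult V) a b"
    and range: "\<forall>j\<in>{1..?d}. 0 \<le> ?\<theta> j \<and> ?\<theta> j \<le> pi / 2"
    and cos: "\<forall>j\<in>{1..?d}. a j \<bullet> b j = cos (?\<theta> j)"
    by (rule principal_angle_cos[OF V subspace_imult[OF V] dim_imult])
  have sin_nonneg: "0 \<le> sin (?\<theta> j)" if "j \<in> {1..?d}" for j
    using bspec[OF range that] by (intro sin_ge_zero) auto
  have sin: "sin (?\<theta> j) = sqrt (1 - (a j \<bullet> b j)\<^sup>2)" if "j \<in> {1..?d}" for j
    unfolding bspec[OF cos that] using sin_nonneg[OF that] by (rule sin_cos_sqrt)
  have index: "2 * j - 1 \<in> {1..?d}" if "j \<in> {1..nat \<lceil>real ?d / 2\<rceil>}" for j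
    using that by auto linarith
  have \<rho>: "holomorphy_index V =
      (\<Prod>j=1..nat \<lceil>real ?d / 2\<rceil>. sqrt (1 - (a (2 * j - 1) \<bullet> b (2 * j - 1))\<^sup>2))"
    unfolding holomorphy_index_def kaehler_angle_def
    by (intro prod.cong refl sin index)
  have "(holomorphy_index V)\<^sup>2 = (\<Prod>j=1..?d. sqrt (1 - (a j \<bullet> b j)\<^sup>2))"
    unfolding \<rho>
  proof (rule prod_pairs)
    show "sqrt (1 - (a (2 * j) \<bullet> b (2 * j))\<^sup>2) = sqrt (1 - (a (2 * j - 1) \<bullet> b (2 * j - 1))\<^sup>2)"
      if "1 \<le> j" "2 * j \<le> ?d" for j
      by (simp only: cosines_paired(1)[OF V ab that])
    show "sqrt (1 - (a ?d \<bullet> b ?d)\<^sup>2) = 1" if "odd ?d"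
      by (simp add: cosines_paired(2)[OF V ab that])
  qed
  moreover have "\<forall>j\<in>{1..?d}. (a j \<bullet> b j)\<^sup>2 \<le> 1"
    by (simp add: cos abs_square_le_1)
  moreover have "0 \<le> holomorphy_index V"
    unfolding holomorphy_index_def kaehler_angle_def
    by (intro prod_nonneg ballI sin_nonneg index)
  ultimately show ?thesis
    by (intro that[OF ab])
qed


section \<open>The disjointness angle\<close>

lemma orth_proj_complement:
  assumes b: "orthonormal_basis W b"
  shows "orth_proj (W\<^sup>\<bottom>) x = x - (\<Sum>k=1..dim W. (x \<bullet> b k) *\<^sub>R b k)"
proof -
  let ?z = "\<Sum>k=1..dim W. (x \<bullet> b k) *\<^sub>R b k"
  have W: "subspace W"
    by (rule subspace_orthonormal_basis[OF b])
  have zW: "?z \<in> W"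
    using W orthonormal_basis_mem[OF b] by (intro subspace_sum subspace_scale)
  have perp: "x - ?z \<in> W\<^sup>\<bottom>"
    unfolding orthogonal_comp_def
  proof (intro CollectI ballI)
    fix w assume "w \<in> W"
    then have "w \<bullet> x = w \<bullet> ?z"
      using orthonormal_basis_Parseval[OF b, of w x] by (simp add: inner_sum_right mult.commute)
    then show "orthogonal w (x - ?z)"
      by (simp add: orthogonal_def inner_diff_right)
  qed
  have zpp: "x - (x - ?z) \<in> W\<^sup>\<bottom>\<^sup>\<bottom>"
    using zW orthogonal_comp_subset[of W] by auto
  show ?thesis
    unfolding orth_proj_def
  proof (rule the_equality)
    fix y assume y: "y \<in> W\<^sup>\<bottom> \<and> x - y \<in> W\<^sup>\<bottom>\<^sup>\<bottom>"
    have 1: "y - (x - ?z) \<in> W\<^sup>\<bottom>"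
      using y perp by (blast intro: subspace_diff[OF subspace_orthogonal_comp])
    have "(x - (x - ?z)) - (x - y) \<in> W\<^sup>\<bottom>\<^sup>\<bottom>"
      using y zpp by (blast intro: subspace_diff[OF subspace_orthogonal_comp])
    then have "y - (x - ?z) \<in> W\<^sup>\<bottom>\<^sup>\<bottom>"
      by (simp add: algebra_simps)
    then have "(y - (x - ?z)) \<bullet> (y - (x - ?z)) = 0"
      using 1 by (auto simp only: orthogonal_comp_def orthogonal_def mem_Collect_eq)
    then show "y = x - ?z" by simp
  qed (intro conjI perp zpp)
qed

lemma linear_orth_proj_complement:
  assumes b: "orthonormal_basis W b"
  shows "linear (orth_proj (W\<^sup>\<bottom>))"
  by (rule linearI)
    (simp_all add: orth_proj_complement[OF b] inner_add_left scaleR_add_left sum.distrib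
      scaleR_sum_right scaleR_diff_right)

lemma real_sqrt_prod: "sqrt (\<Prod>i\<in>A. f i) = (\<Prod>i\<in>A. sqrt (f i))"
  by (induction A rule: infinite_finite_induct) (simp_all add: real_sqrt_mult)

text \<open>
  Principal bases diagonalise the situation: the projection to the orthogonal complement of
  \<open>W\<close> takes \<open>a j\<close> to \<open>a j - cos \<theta>\<^sub>j b j\<close>, and these vectors are orthogonal with norms
  \<open>sin \<theta>\<^sub>j\<close>.
\<close>
lemma sin_disjointness_angle:
  assumes ab: "principal_bases V W a b" and dim: "dim W = dim V"
    and le: "\<forall>j\<in>{1..dim V}. (a j \<bullet> b j)\<^sup>2 \<le> 1"
  shows "sin (disjointness_angle V W) = (\<Prod>j=1..dim V. sqrt (1 - (a j \<bullet> b j)\<^sup>2))"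
proof -
  let ?d = "dim V" and ?P = "orth_proj (W\<^sup>\<bottom>)"
  note a = principal_basesD(1)[OF ab] and b = principal_basesD(2)[OF ab]
    and off = principal_basesD(3)[OF ab]
  define e where "e = (SOME b. is_basis V b)"
  have e: "is_basis V e"
    unfolding e_def by (rule someI[of "is_basis V", OF is_basis_of_orthonormal[OF a]])
  have Pa: "?P (a j) = a j - (a j \<bullet> b j) *\<^sub>R b j" if "j \<in> {1..?d}" for j
  proof -
    have "(\<Sum>k=1..?d. (a j \<bullet> b k) *\<^sub>R b k) = (\<Sum>k=1..?d. if k = j then (a j \<bullet> b k) *\<^sub>R b k else 0)"
      using off[OF that] by (intro sum.cong) auto
    then show ?thesis
      using that by (simp add: orth_proj_complement[OF b] dim)
  qed
  have "gram_det (\<bullet>) ?d (\<lambda>j. ?P (a j)) = ldet ?d (\<lambda>j k. if j = k then 1 - (a j \<bullet> b j)\<^sup>2 else 0)"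
  proof (subst gram_det_eq_ldet, rule ldet_cong)
    fix j k assume jk: "j \<in> {1..?d}" "k \<in> {1..?d}"
    show "?P (a j) \<bullet> ?P (a k) = (if j = k then 1 - (a j \<bullet> b j)\<^sup>2 else 0)"
      using orthonormal_basis_inner[OF a jk] orthonormal_basis_inner[OF b] off[OF jk] off[OF jk(2,1)] jk
      by (auto simp: Pa inner_diff_left inner_diff_right dim power2_eq_square inner_commute)
  qed
  then have P: "gram_det (\<bullet>) ?d (\<lambda>j. ?P (a j)) = (\<Prod>j=1..?d. 1 - (a j \<bullet> b j)\<^sup>2)"
    by (simp add: ldet_diag)
  have "rwedge_norm ?d (rwedge ?d (\<lambda>j. ?P (e j))) / rwedge_norm ?d (rwedge ?d e)
      = sqrt (\<Prod>j=1..?d. 1 - (a j \<bullet> b j)\<^sup>2)"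
    using gram_det_basis(1)[OF a e] gram_det_basis(2)[OF a e linear_orth_proj_complement[OF b]]
    by (simp add: rwedge_norm_gram P real_sqrt_mult)
  also have "\<dots> = (\<Prod>j=1..?d. sqrt (1 - (a j \<bullet> b j)\<^sup>2))"
    by (rule real_sqrt_prod)
  finally have angle: "disjointness_angle V W = arcsin (\<Prod>j=1..?d. sqrt (1 - (a j \<bullet> b j)\<^sup>2))"
    unfolding disjointness_angle_def Let_def e_def by (rule arg_cong)
  have 0: "0 \<le> (\<Prod>j=1..?d. sqrt (1 - (a j \<bullet> b j)\<^sup>2))"
    using le by (intro prod_nonneg) auto
  have 1: "(\<Prod>j=1..?d. sqrt (1 - (a j \<bullet> b j)\<^sup>2)) \<le> 1"
    using le by (intro prod_le_1) auto
  show ?thesis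
    unfolding angle by (rule sin_arcsin[OF order_trans[OF _ 0] 1]) simp
qed


section \<open>Complex and real exterior products\<close>

text \<open>
  The complex Gram matrix \<open>H\<close> of an orthonormal basis \<open>a\<close> of \<open>V\<close> is \<open>1 + \<i> S\<close> with
  \<open>S\<close> real and skew, where \<open>S j l = \<langle>a j, \<i> a l\<rangle>\<close>. Hence \<open>H H\<^sup>T = 1 - S S\<^sup>T\<close>, and
  \<open>S S\<^sup>T\<close> is the Gram matrix of the projections of the \<open>a j\<close> to \<open>\<i>V\<close>. For principal
  bases that matrix is diagonal, with the squared cosines as entries.
\<close>
lemma gram_det_herm_squared:
  fixes V :: "(complex^'n) set"
  assumes V: "subspace V" and ab: "principal_bases V (imult V) a b"
  shows "(gram_det herm (dim V) a)\<^sup>2 = of_real (\<Prod>j=1..dim V. 1 - (a j \<bullet> b j)\<^sup>2)"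
proof -
  let ?d = "dim V"
  note a = principal_basesD(1)[OF ab] and b = principal_basesD(2)[OF ab]
    and off = principal_basesD(3)[OF ab]
  \<comment> \<open>the imaginary parts of the entries are inner products with this orthonormal basis of \<open>\<i>V\<close>,
    which may be exchanged for \<open>b\<close> in sums of products\<close>
  let ?b = "\<lambda>k. \<i> *s a k"
  have b': "orthonormal_basis (imult V) ?b"
  proof (rule orthonormal_basisI[OF subspace_imult[OF V]], unfold dim_imult)
    show "?b j \<in> imult V" if "j \<in> {1..?d}" for j
      using orthonormal_basis_mem[OF a that] by (simp add: imult_def)
    show "?b j \<bullet> ?b k = (if j = k then 1 else 0)" if "j \<in> {1..?d}" "k \<in> {1..?d}" for j k
      using orthonormal_basis_inner[OF a that] by (simp add: inner_imult_imult)
  qed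
  have entry: "(\<Sum>l=1..?d. herm (a j) (a l) * herm (a k) (a l)) =
      (if j = k then of_real (1 - (a j \<bullet> b j)\<^sup>2) else 0)" if jk: "j \<in> {1..?d}" "k \<in> {1..?d}" for j k
  proof -
    have "(\<Sum>l=1..?d. (a j \<bullet> ?b l) * (a k \<bullet> ?b l)) = (\<Sum>l=1..?d. (a j \<bullet> b l) * (a k \<bullet> b l))"
      using orthonormal_basis_projection_unique[OF b' b] by (simp add: dim_imult)
    also have "\<dots> = (if j = k then (a j \<bullet> b j)\<^sup>2 else 0)"
    proof -
      have "(\<Sum>l=1..?d. (a j \<bullet> b l) * (a k \<bullet> b l)) = 
        (\<Sum>l=1..?d. if l = j then (a j \<bullet> b l) * (a k \<bullet> b l) else 0)"
        using off jk by (intro sum.cong) auto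
      then show ?thesis
        using off[of k j] jk by (auto simp: power2_eq_square)
    qed
    finally have sq: "(\<Sum>l=1..?d. (a j \<bullet> ?b l) * (a k \<bullet> ?b l)) = (if j = k then (a j \<bullet> b j)\<^sup>2 else 0)" .
    have h: "herm (a i) (a l) = (if l = i then 1 else 0) + \<i> * of_real (a i \<bullet> ?b l)"
      if "i \<in> {1..?d}" "l \<in> {1..?d}" for i l
      using orthonormal_basis_inner[OF a that] by (simp add: herm_eq_inner)
    have "(\<Sum>l=1..?d. herm (a j) (a l) * herm (a k) (a l)) =
       (\<Sum>l=1..?d. (if l = j then herm (a k) (a l) else 0) +
          (if l = k then \<i> * of_real (a j \<bullet> ?b l) else 0) - of_real ((a j \<bullet> ?b l) * (a k \<bullet> ?b l)))"
      using jk by (intro sum.cong) (auto simp: h algebra_simps)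
    also have "\<dots> = herm (a k) (a j) + \<i> * of_real (a j \<bullet> ?b k) -
        of_real (\<Sum>l=1..?d. (a j \<bullet> ?b l) * (a k \<bullet> ?b l))"
      using jk by (simp add: sum.distrib sum_subtractf)
    also have "a j \<bullet> ?b k = - (a k \<bullet> ?b j)"
      using inner_imult[of "a j" "a k"] by (simp add: inner_commute)
    finally show ?thesis
      unfolding sq using jk by (auto simp: h)
  qed
  have "(gram_det herm ?d a)\<^sup>2 = ldet ?d (\<lambda>j l. herm (a j) (a l)) * ldet ?d (\<lambda>l j. herm (a j) (a l))"
    by (simp add: gram_det_eq_ldet[of herm] power2_eq_square ldet_transpose[where A = "\<lambda>j l. herm (a j) (a l)"])
  also have "\<dots> = ldet ?d (\<lambda>j k. \<Sum>l=1..?d. herm (a j) (a l) * herm (a k) (a l))"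
    by (rule ldet_mult[symmetric])
  also have "\<dots> = ldet ?d (\<lambda>j k. if j = k then of_real (1 - (a j \<bullet> b j)\<^sup>2) else 0)"
    using entry by (rule ldet_cong)
  also have "\<dots> = (\<Prod>j=1..?d. of_real (1 - (a j \<bullet> b j)\<^sup>2))"
    by (rule ldet_diag)
  finally show ?thesis by simp
qed

text \<open>
  One real factor relates the real and the complex Gram determinant of the generators to those of
  an orthonormal basis of their real span. It is zero when the generators are linearly dependent
  over the reals.
\<close>
lemma gram_det_generators:
  fixes v :: "nat \<Rightarrow> complex^'n" and V :: "(complex^'n) set"
  assumes V: "V = span (v ` {1..p})" and a: "orthonormal_basis V a"
  obtains c where "gram_det (\<bullet>) p v = c\<^sup>2"
    "gram_det herm p v = of_real (c\<^sup>2) * gram_det herm (dim V) a"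
proof -
  \<comment> \<open>\<open>p\<close> may exceed the dimension: the coefficient matrix is then padded by zero columns, its
    determinant vanishes, and the values of \<open>a\<close> beyond the dimension do not matter\<close>
  define C where "C j l = (if l \<le> dim V then v j \<bullet> a l else 0)" for j l
  have "dim V \<le> card (v ` {1..p})"
    unfolding V dim_span by (rule dim_le_card') simp
  also have "\<dots> \<le> p"
    using card_image_le[of "{1..p}" v] by simp
  finally have dp: "dim V \<le> p" .
  have v: "v j = (\<Sum>l=1..p. C j l *\<^sub>R a l)" if "j \<in> {1..p}" for j
  proof -
    have "v j \<in> V"
      unfolding V using that by (intro span_base) auto
    then have "v j = (\<Sum>l=1..dim V. C j l *\<^sub>R a l)"
      using orthonormal_basis_expansion[OF a, of "v j"] by (simp add: C_def)
    also have "\<dots> = (\<Sum>l=1..p. C j l *\<^sub>R a l)"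
      using dp by (intro sum.mono_neutral_left) (auto simp: C_def)
    finally show ?thesis .
  qed
  have r: "gram_det (\<bullet>) p v = (ldet p C)\<^sup>2 * gram_det (\<bullet>) p a"
    using gram_det_linear_combination[OF bilinear_inner_linear[OF linear_id] v] by simp
  have h: "gram_det herm p v = of_real ((ldet p C)\<^sup>2) * gram_det herm p a"
    by (rule gram_det_linear_combination[OF bilinear_herm v])
  show ?thesis
  proof (cases "p = dim V")
    case True
    show ?thesis
      using r h by (intro that[of "ldet p C"]) (simp_all add: True gram_det_orthonormal[OF a])
  next
    case False
    have "ldet p C = 0"
      using dp False by (intro ldet_zero_column[of p]) (auto simp: C_def)
    then show ?thesis
      using r h by (intro that[of 0]) simp_all
  qed
qed

theorem proposition5p6:
  fixes v :: "nat \<Rightarrow> complex^'n" and p :: nat and V :: "(complex^'n) set"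
  assumes "V = span (v ` {1..p})"
  shows "(holomorphy_index V)\<^sup>2 = sin (disjointness_angle V (imult V)) \<and>
    cwedge_norm p (cwedge p v) = holomorphy_index V * rwedge_norm p (rwedge p v)"
proof -
  let ?d = "dim V" and ?\<rho> = "holomorphy_index V"
  have V: "subspace V"
    by (simp add: assms)
  obtain a b where ab: "principal_bases V (imult V) a b"
    and \<rho>: "?\<rho>\<^sup>2 = (\<Prod>j=1..?d. sqrt (1 - (a j \<bullet> b j)\<^sup>2))"
    and le: "\<forall>j\<in>{1..?d}. (a j \<bullet> b j)\<^sup>2 \<le> 1" and nn: "0 \<le> ?\<rho>"
    by (rule holomorphy_index_squared[OF V])
  obtain c where c: "gram_det (\<bullet>) p v = c\<^sup>2"
    "gram_det herm p v = of_real (c\<^sup>2) * gram_det herm ?d a"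
    by (rule gram_det_generators[OF assms principal_basesD(1)[OF ab]])
  define g where "g = (cwedge_norm ?d (cwedge ?d a))\<^sup>2"
  have g: "gram_det herm ?d a = of_real g"
    unfolding g_def by (rule cwedge_norm_gram[symmetric])
  have "(?\<rho>\<^sup>2)\<^sup>2 = (\<Prod>j=1..?d. 1 - (a j \<bullet> b j)\<^sup>2)"
    unfolding \<rho> prod_power_distrib using le by (intro prod.cong) auto
  also have "\<dots> = g\<^sup>2"
    using gram_det_herm_squared[OF V ab] unfolding g of_real_power[symmetric] of_real_eq_iff by simp
  finally have g\<rho>: "g = ?\<rho>\<^sup>2"
    using power2_eq_imp_eq[of g "?\<rho>\<^sup>2"] by (simp add: g_def)
  have "complex_of_real ((cwedge_norm p (cwedge p v))\<^sup>2) = of_real ((?\<rho> * c)\<^sup>2)"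
    unfolding cwedge_norm_gram c g g\<rho> by (simp add: power_mult_distrib mult.commute)
  then have "(cwedge_norm p (cwedge p v))\<^sup>2 = (?\<rho> * \<bar>c\<bar>)\<^sup>2"
    unfolding of_real_eq_iff by (simp add: power_mult_distrib)
  then have "cwedge_norm p (cwedge p v) = ?\<rho> * \<bar>c\<bar>"
  proof (rule power2_eq_imp_eq)
    show "0 \<le> cwedge_norm p (cwedge p v)"
      by (simp add: cwedge_norm_def ext_norm_def sum_nonneg)
    show "0 \<le> ?\<rho> * \<bar>c\<bar>"
      by (rule mult_nonneg_nonneg[OF nn abs_ge_zero])
  qed
  then have "cwedge_norm p (cwedge p v) = ?\<rho> * rwedge_norm p (rwedge p v)"
    by (simp add: rwedge_norm_gram c)
  moreover have "?\<rho>\<^sup>2 = sin (disjointness_angle V (imult V))"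
    unfolding \<rho> by (rule sin_disjointness_angle[OF ab dim_imult le, symmetric])
  ultimately show ?thesis by blast
qed

end
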